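(* Let $f\in C^\infty(\mathbb R)$ and suppose that the non-hysteretic system in $\mathbb R^3$ $$\dot x=u_1,\qquad \dot y=u_2,\qquad \dot z=f(x)\,u_2$$ is controllable by piecewise constant controls. Let $\rho>0$, let $A=(x_A,y_A,z_A)$ and $B=(x_B,y_B,z_B)$ be any points of $\mathbb R^3$, let $T>0$ be a time in which some piecewise constant control $(\bar u_1,\bar u_2)$ steers the non-hysteretic system from $A$ to $B$, and let $w_0\in\mathbb R$ be such that $|x_A-w_0|\le\rho$. Then there exist a sequence of piecewise constant controls $(u_1^j,u_2^j)_{j}$ and a final time $T^*\ge T$ such that the solutions $(x^j,y^j,z^j)$ of the hysteretic system $$\dot x=u_1^j,\qquad \dot y=u_2^j,\qquad \dot z=f(\mathcal P[x,w_0])\,u_2^j,\qquad (x,y,z)(0)=A,$$ satisfy $$x^j(T^* )=x_B,\qquad y^j(T^* )=y_B\quad\text{for all } j,\qquad z^j(T^* )\to z_B\ \text{ as } j\to\infty .$$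
   Context: Play operator. Fix $\rho>0$. On a time interval $[0,S]$, for $u\in W^{1,1}(0,S)$ and $w_0\in\mathbb R$ with $|u(0)-w_0|\le\rho$, $w=\mathcal P[u,w_0]$ is the unique absolutely continuous function on $[0,S]$ with $w(0)=w_0$, $|u(t)-w(t)|\le\rho$ for all $t$, and $\dot w(t)\,(u(t)-w(t)-v)\ge 0$ for all $v$ with $|v|\le\rho$ and a.e. $t$. $\mathcal P$ is extended to continuous inputs by continuity in the uniform norm. A control system is controllable (by piecewise constant controls) if for any two points $A,B$ of the state space there are a time $T>0$ and a piecewise constant control on $[0,T]$ such that the trajectory starting from $A$ reaches $B$ at time $T$. *)

theory Defs
  imports "HOL-Analysis.Analysis"
begin

definition smooth :: "(real \<Rightarrow> real) \<Rightarrow> bool" where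
  "smooth f \<longleftrightarrow> (\<forall>n. (deriv ^^ n) f differentiable_on UNIV)"

definition abs_cont_on :: "real \<Rightarrow> real \<Rightarrow> (real \<Rightarrow> real) \<Rightarrow> bool" where
  "abs_cont_on a b f \<longleftrightarrow>
    (\<forall>\<epsilon>>0. \<exists>\<delta>>0. \<forall>(n::nat) l r.
      (\<forall>i<n. a \<le> l i \<and> l i \<le> r i \<and> r i \<le> b) \<and>
      (\<forall>i<n. \<forall>k<n. i \<noteq> k \<longrightarrow> {l i<..<r i} \<inter> {l k<..<r k} = {}) \<and>
      (\<Sum>i<n. r i - l i) < \<delta>
      \<longrightarrow> (\<Sum>i<n. \<bar>f (r i) - f (l i)\<bar>) < \<epsilon>)"

(* The values at the finitely many breakpoints are unconstrained. *)
definition pw_const_on :: "real \<Rightarrow> (real \<Rightarrow> real) \<Rightarrow> bool" where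
  "pw_const_on T u \<longleftrightarrow>
    (\<exists>(n::nat) t. t 0 = 0 \<and> t n = T \<and> (\<forall>i<n. t i < t (Suc i)) \<and>
      (\<forall>i<n. \<exists>c. \<forall>s\<in>{t i<..<t (Suc i)}. u s = c))"

definition is_play :: "real \<Rightarrow> real \<Rightarrow> (real \<Rightarrow> real) \<Rightarrow> real \<Rightarrow> (real \<Rightarrow> real) \<Rightarrow> bool" where
  "is_play \<rho> S u w0 w \<longleftrightarrow>
    abs_cont_on 0 S w \<and> w 0 = w0 \<and>
    (\<forall>t\<in>{0..S}. \<bar>u t - w t\<bar> \<le> \<rho>) \<and>
    (AE t\<in>{0<..<S} in lborel. \<exists>d. (w has_real_derivative d) (at t) \<and>
       (\<forall>v. \<bar>v\<bar> \<le> \<rho> \<longrightarrow> d * (u t - w t - v) \<ge> 0))"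

(* A play is unique only as a function on {0..S}; extensionality pins down its values elsewhere.
   The definition is meaningful for absolutely continuous u with \<bar>u 0 - w0\<bar> \<le> \<rho>, the only
   inputs that occur as components of trajectories of the system below. *)
definition play :: "real \<Rightarrow> real \<Rightarrow> (real \<Rightarrow> real) \<Rightarrow> real \<Rightarrow> real \<Rightarrow> real" where
  "play \<rho> S u w0 = (THE w. w \<in> extensional {0..S} \<and> is_play \<rho> S u w0 w)"

(* Solution of x' = g in the sense of Caratheodory. *)
definition ode_sol :: "real \<Rightarrow> (real \<Rightarrow> real) \<Rightarrow> (real \<Rightarrow> real) \<Rightarrow> bool" where
  "ode_sol T g x \<longleftrightarrow>
    abs_cont_on 0 T x \<and> (AE t\<in>{0<..<T} in lborel. (x has_real_derivative g t) (at t))"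

definition nonhyst_sol ::
  "(real \<Rightarrow> real) \<Rightarrow> real \<Rightarrow> (real \<Rightarrow> real) \<Rightarrow> (real \<Rightarrow> real) \<Rightarrow> real \<times> real \<times> real \<Rightarrow>
   (real \<Rightarrow> real) \<Rightarrow> (real \<Rightarrow> real) \<Rightarrow> (real \<Rightarrow> real) \<Rightarrow> bool" where
  "nonhyst_sol f T u1 u2 A x y z \<longleftrightarrow>
    ode_sol T u1 x \<and> ode_sol T u2 y \<and> ode_sol T (\<lambda>t. f (x t) * u2 t) z \<and>
    (x 0, y 0, z 0) = A"

definition hyst_sol ::
  "(real \<Rightarrow> real) \<Rightarrow> real \<Rightarrow> real \<Rightarrow> real \<Rightarrow> (real \<Rightarrow> real) \<Rightarrow> (real \<Rightarrow> real) \<Rightarrow> real \<times> real \<times> real \<Rightarrow>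
   (real \<Rightarrow> real) \<Rightarrow> (real \<Rightarrow> real) \<Rightarrow> (real \<Rightarrow> real) \<Rightarrow> bool" where
  "hyst_sol f \<rho> w0 T u1 u2 A x y z \<longleftrightarrow>
    ode_sol T u1 x \<and> ode_sol T u2 y \<and> ode_sol T (\<lambda>t. f (play \<rho> T x w0 t) * u2 t) z \<and>
    (x 0, y 0, z 0) = A"

definition nonhyst_steers ::
  "(real \<Rightarrow> real) \<Rightarrow> real \<Rightarrow> (real \<Rightarrow> real) \<Rightarrow> (real \<Rightarrow> real) \<Rightarrow>
   real \<times> real \<times> real \<Rightarrow> real \<times> real \<times> real \<Rightarrow> bool" where
  "nonhyst_steers f T u1 u2 A B \<longleftrightarrow>
    (\<exists>x y z. nonhyst_sol f T u1 u2 A x y z \<and> (x T, y T, z T) = B)"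

definition nonhyst_controllable :: "(real \<Rightarrow> real) \<Rightarrow> bool" where
  "nonhyst_controllable f \<longleftrightarrow>
    (\<forall>A B. \<exists>T>0. \<exists>u1 u2. pw_const_on T u1 \<and> pw_const_on T u2 \<and> nonhyst_steers f T u1 u2 A B)"

end

(* If f were constant, z - f y would be conserved, so controllability yields some b with
   f b \<noteq> f w0. While x rests, the play rests as well, so moving y at play values w0 and then b
   adds multiples of f w0 and f b to z. Hence four phases of length T reach the target exactly:
   move y; move x past b by \<rho>, which drags the play to b; move y; move x to xB. The two
   displacements of y solve a 2x2 linear system of determinant f b - f w0, and the sequence of
   controls can be taken constant. *)

theory Submission
  imports Defs
begin

text \<open>The conclusion speaks about every solution of the hysteretic system, and
  \<open>play\<close> is a definite description, so exhibiting one trajectory is not enough: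
  uniqueness is needed both for Caratheodory solutions and for the play. Both rest on one fact, that
  an absolutely continuous function with a nonnegative derivative almost everywhere does not
  decrease. It is applied to differences of two solutions and to minus the squared distance of two
  plays.

  Existence comes from explicit formulas. On a monotone stretch of input the play is a clamp of its
  value at the start of the stretch. The input built here is monotone over the first three phases
  and again over the fourth, so two nested clamps describe its play. The fourth phase may drag the
  play away from \<open>b\<close>, but \<open>y\<close> then rests, so \<open>z\<close> does not
  feel it.\<close>

section \<open>Absolutely continuous functions and their derivatives almost everywhere\<close>

lemma abs_cont_onD:
  assumes "abs_cont_on a b f" and "\<epsilon> > 0"
  shows "\<exists>\<delta>>0. \<forall>(n::nat) l r.
      (\<forall>i<n. a \<le> l i \<and> l i \<le> r i \<and> r i \<le> b) \<and>
      (\<forall>i<n. \<forall>k<n. i \<noteq> k \<longrightarrow> {l i<..<r i} \<inter> {l k<..<r k} = {}) \<and>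
      (\<Sum>i<n. r i - l i) < \<delta> \<longrightarrow> (\<Sum>i<n. \<bar>f (r i) - f (l i)\<bar>) < \<epsilon>"
  using assms unfolding abs_cont_on_def by (elim allE impE)

text \<open>The intervals of a tagged division form a finite set of pairs without a preferred
  numbering; a bijection with an initial segment of the naturals makes the definition applicable to
  them.\<close>

lemma abs_cont_on_finiteD:
  assumes "abs_cont_on a b f" and "\<epsilon> > 0"
  shows "\<exists>\<delta>>0. \<forall>(I :: 'i set) l r. finite I \<longrightarrow> (\<forall>i\<in>I. a \<le> l i \<and> l i \<le> r i \<and> r i \<le> b) \<longrightarrow>
           disjoint_family_on (\<lambda>i. {l i<..<r i}) I \<longrightarrow> (\<Sum>i\<in>I. r i - l i) < \<delta> \<longrightarrow>
           (\<Sum>i\<in>I. \<bar>f (r i) - f (l i)\<bar>) < \<epsilon>"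
proof -
  obtain \<delta> where "\<delta> > 0" and \<delta>: "\<forall>(n::nat) l r.
      (\<forall>i<n. a \<le> l i \<and> l i \<le> r i \<and> r i \<le> b) \<and>
      (\<forall>i<n. \<forall>k<n. i \<noteq> k \<longrightarrow> {l i<..<r i} \<inter> {l k<..<r k} = {}) \<and>
      (\<Sum>i<n. r i - l i) < \<delta> \<longrightarrow> (\<Sum>i<n. \<bar>f (r i) - f (l i)\<bar>) < \<epsilon>"
    using abs_cont_onD[OF assms] by (elim exE conjE)
  show ?thesis
  proof (intro exI[of _ \<delta>] conjI allI impI \<open>\<delta> > 0\<close>)
    fix I :: "'i set" and l r :: "'i \<Rightarrow> real"
    assume fin: "finite I" and bnd: "\<forall>i\<in>I. a \<le> l i \<and> l i \<le> r i \<and> r i \<le> b"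
      and disj: "disjoint_family_on (\<lambda>i. {l i<..<r i}) I" and small: "(\<Sum>i\<in>I. r i - l i) < \<delta>"
    obtain h where h: "bij_betw h {..<card I} I"
      using ex_bij_betw_nat_finite[OF fin] by (auto simp: atLeast0LessThan)
    have hI: "h i \<in> I" if "i < card I" for i
      using h that by (auto simp: bij_betw_def)
    have "(\<Sum>i<card I. \<bar>f (r (h i)) - f (l (h i))\<bar>) < \<epsilon>"
    proof (rule \<delta>[rule_format], intro conjI allI impI)
      fix i k assume ik: "i < card I" "k < card I" "i \<noteq> k"
      then have "h i \<noteq> h k"
        using h by (auto simp: bij_betw_def inj_on_def)
      then show "{l (h i)<..<r (h i)} \<inter> {l (h k)<..<r (h k)} = {}"
        using disj hI ik unfolding disjoint_family_on_def by blast
    next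
      show "(\<Sum>i<card I. r (h i) - l (h i)) < \<delta>"
        using small sum.reindex_bij_betw[OF h, of "\<lambda>i. r i - l i"] by simp
    qed (use bnd hI in auto)
    then show "(\<Sum>i\<in>I. \<bar>f (r i) - f (l i)\<bar>) < \<epsilon>"
      using sum.reindex_bij_betw[OF h, of "\<lambda>i. \<bar>f (r i) - f (l i)\<bar>"] by simp
  qed
qed

lemma abs_cont_on_subinterval:
  assumes "abs_cont_on a b f" and "a \<le> c" and "d \<le> b"
  shows "abs_cont_on c d f"
  unfolding abs_cont_on_def
proof (intro allI impI)
  fix \<epsilon> :: real assume "\<epsilon> > 0"
  then obtain \<delta> where "\<delta> > 0" and \<delta>: "\<forall>(n::nat) l r.
      (\<forall>i<n. a \<le> l i \<and> l i \<le> r i \<and> r i \<le> b) \<and>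
      (\<forall>i<n. \<forall>k<n. i \<noteq> k \<longrightarrow> {l i<..<r i} \<inter> {l k<..<r k} = {}) \<and>
      (\<Sum>i<n. r i - l i) < \<delta> \<longrightarrow> (\<Sum>i<n. \<bar>f (r i) - f (l i)\<bar>) < \<epsilon>"
    using abs_cont_onD[OF assms(1)] by blast
  show "\<exists>\<delta>>0. \<forall>(n::nat) l r. (\<forall>i<n. c \<le> l i \<and> l i \<le> r i \<and> r i \<le> d) \<and>
      (\<forall>i<n. \<forall>k<n. i \<noteq> k \<longrightarrow> {l i<..<r i} \<inter> {l k<..<r k} = {}) \<and> (\<Sum>i<n. r i - l i) < \<delta>
      \<longrightarrow> (\<Sum>i<n. \<bar>f (r i) - f (l i)\<bar>) < \<epsilon>"
  proof (intro exI[of _ \<delta>] conjI allI impI \<open>\<delta> > 0\<close>, elim conjE)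
    fix n :: nat and l r :: "nat \<Rightarrow> real"
    assume "\<forall>i<n. c \<le> l i \<and> l i \<le> r i \<and> r i \<le> d"
    then have "\<forall>i<n. a \<le> l i \<and> l i \<le> r i \<and> r i \<le> b"
      using assms(2,3) by force
    moreover assume "\<forall>i<n. \<forall>k<n. i \<noteq> k \<longrightarrow> {l i<..<r i} \<inter> {l k<..<r k} = {}"
      "(\<Sum>i<n. r i - l i) < \<delta>"
    ultimately show "(\<Sum>i<n. \<bar>f (r i) - f (l i)\<bar>) < \<epsilon>"
      by (intro \<delta>[rule_format] conjI)
  qed
qed

lemma abs_cont_on_ident: "abs_cont_on a b (\<lambda>t. t)"
  unfolding abs_cont_on_def
proof (intro allI impI)
  fix \<epsilon> :: real assume "\<epsilon> > 0"
  show "\<exists>\<delta>>0. \<forall>(n::nat) l r. (\<forall>i<n. a \<le> l i \<and> l i \<le> r i \<and> r i \<le> b) \<and>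
      (\<forall>i<n. \<forall>k<n. i \<noteq> k \<longrightarrow> {l i<..<r i} \<inter> {l k<..<r k} = {}) \<and> (\<Sum>i<n. r i - l i) < \<delta>
      \<longrightarrow> (\<Sum>i<n. \<bar>r i - l i\<bar>) < \<epsilon>"
  proof (intro exI[of _ \<epsilon>] conjI allI impI \<open>\<epsilon> > 0\<close>, elim conjE)
    fix n :: nat and l r :: "nat \<Rightarrow> real"
    assume *: "\<forall>i<n. a \<le> l i \<and> l i \<le> r i \<and> r i \<le> b" "(\<Sum>i<n. r i - l i) < \<epsilon>"
    have "(\<Sum>i<n. \<bar>r i - l i\<bar>) = (\<Sum>i<n. r i - l i)"
      using * by (intro sum.cong) auto
    then show "(\<Sum>i<n. \<bar>r i - l i\<bar>) < \<epsilon>" using * by simp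
  qed
qed

text \<open>One comparison principle supplies every closure property used later: Lipschitz functions
  (compare with the identity), differences, scalar multiples, the squared distance of two plays, and
  a function altered outside the interval.\<close>

lemma abs_cont_on_dominated:
  assumes f: "abs_cont_on a b f" and g: "abs_cont_on a b g" and "C \<ge> 0"
    and dom: "\<And>s t. \<lbrakk>a \<le> s; s \<le> t; t \<le> b\<rbrakk> \<Longrightarrow> \<bar>h t - h s\<bar> \<le> C * (\<bar>f t - f s\<bar> + \<bar>g t - g s\<bar>)"
  shows "abs_cont_on a b h"
  unfolding abs_cont_on_def
proof (intro allI impI)
  fix \<epsilon> :: real assume "\<epsilon> > 0"
  \<comment> \<open>The \<open>+ 1\<close> permits \<open>C = 0\<close> and makes the final bound
    \<open>2 * C * \<eta> < \<epsilon>\<close> strict.\<close>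
  define \<eta> where "\<eta> = \<epsilon> / (2 * (C + 1))"
  have \<eta>: "\<eta> > 0" using \<open>\<epsilon> > 0\<close> \<open>C \<ge> 0\<close> by (simp add: \<eta>_def)
  obtain d1 where "d1 > 0" and d1: "\<forall>(n::nat) l r.
      (\<forall>i<n. a \<le> l i \<and> l i \<le> r i \<and> r i \<le> b) \<and>
      (\<forall>i<n. \<forall>k<n. i \<noteq> k \<longrightarrow> {l i<..<r i} \<inter> {l k<..<r k} = {}) \<and>
      (\<Sum>i<n. r i - l i) < d1 \<longrightarrow> (\<Sum>i<n. \<bar>f (r i) - f (l i)\<bar>) < \<eta>"
    using abs_cont_onD[OF f \<eta>] by (elim exE conjE)
  obtain d2 where "d2 > 0" and d2: "\<forall>(n::nat) l r.
      (\<forall>i<n. a \<le> l i \<and> l i \<le> r i \<and> r i \<le> b) \<and>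
      (\<forall>i<n. \<forall>k<n. i \<noteq> k \<longrightarrow> {l i<..<r i} \<inter> {l k<..<r k} = {}) \<and>
      (\<Sum>i<n. r i - l i) < d2 \<longrightarrow> (\<Sum>i<n. \<bar>g (r i) - g (l i)\<bar>) < \<eta>"
    using abs_cont_onD[OF g \<eta>] by (elim exE conjE)
  show "\<exists>\<delta>>0. \<forall>(n::nat) l r. (\<forall>i<n. a \<le> l i \<and> l i \<le> r i \<and> r i \<le> b) \<and>
      (\<forall>i<n. \<forall>k<n. i \<noteq> k \<longrightarrow> {l i<..<r i} \<inter> {l k<..<r k} = {}) \<and> (\<Sum>i<n. r i - l i) < \<delta>
      \<longrightarrow> (\<Sum>i<n. \<bar>h (r i) - h (l i)\<bar>) < \<epsilon>"
  proof (intro exI[of _ "min d1 d2"] conjI allI impI, goal_cases)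
    case 1 show ?case using \<open>d1 > 0\<close> \<open>d2 > 0\<close> by simp
  next
    case (2 n l r)
    then have *: "\<forall>i<n. a \<le> l i \<and> l i \<le> r i \<and> r i \<le> b"
      "\<forall>i<n. \<forall>k<n. i \<noteq> k \<longrightarrow> {l i<..<r i} \<inter> {l k<..<r k} = {}"
      "(\<Sum>i<n. r i - l i) < d1" "(\<Sum>i<n. r i - l i) < d2"
      by auto
    have "(\<Sum>i<n. \<bar>h (r i) - h (l i)\<bar>)
        \<le> (\<Sum>i<n. C * (\<bar>f (r i) - f (l i)\<bar> + \<bar>g (r i) - g (l i)\<bar>))"
      using * dom by (intro sum_mono) simp
    also have "\<dots> = C * ((\<Sum>i<n. \<bar>f (r i) - f (l i)\<bar>) + (\<Sum>i<n. \<bar>g (r i) - g (l i)\<bar>))"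
      by (simp add: sum_distrib_left sum.distrib distrib_left)
    also have "\<dots> \<le> C * (\<eta> + \<eta>)"
      using d1[rule_format, of n l r] d2[rule_format, of n l r] * \<open>C \<ge> 0\<close>
      by (intro mult_left_mono add_mono) simp_all
    also have "\<dots> < \<epsilon>"
    proof -
      have "2 * (C + 1) * \<eta> = \<epsilon>" using \<open>C \<ge> 0\<close> by (simp add: \<eta>_def)
      then show ?thesis using \<eta> by (simp add: algebra_simps)
    qed
    finally show ?case .
  qed
qed

lemma lipschitz_on_imp_abs_cont_on:
  assumes "C-lipschitz_on {a..b} f"
  shows "abs_cont_on a b f"
proof (rule abs_cont_on_dominated[OF abs_cont_on_ident abs_cont_on_ident lipschitz_on_nonneg[OF assms]])
  fix s t assume *: "a \<le> s" "s \<le> t" "t \<le> b"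
  then have "\<bar>f t - f s\<bar> \<le> C * \<bar>t - s\<bar>"
    using lipschitz_onD[OF assms, of t s] by (simp add: dist_real_def)
  also have "\<dots> \<le> C * (\<bar>t - s\<bar> + \<bar>t - s\<bar>)"
    using lipschitz_on_nonneg[OF assms] by (intro mult_left_mono) auto
  finally show "\<bar>f t - f s\<bar> \<le> C * (\<bar>t - s\<bar> + \<bar>t - s\<bar>)" .
qed

lemma abs_cont_on_diff:
  assumes "abs_cont_on a b f" "abs_cont_on a b g"
  shows "abs_cont_on a b (\<lambda>t. f t - g t)"
  by (rule abs_cont_on_dominated[OF assms, of 1]) auto

text \<open>The derivative controls the increments over those intervals of a fine tagged division whose
  tag is a good point; the remaining intervals lie in an open set of small measure, so absolute
  continuity controls their increments.\<close>

lemma abs_cont_on_AE_deriv_nonneg_imp_le: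
  assumes "a \<le> b" and ac: "abs_cont_on a b h"
    and deriv: "AE t\<in>{a<..<b} in lborel. \<exists>d\<ge>0. (h has_real_derivative d) (at t)"
  shows "h a \<le> h b"
proof -
  have main: "h a - h b \<le> \<epsilon> * (b - a) + \<epsilon>" if "\<epsilon> > 0" for \<epsilon> :: real
  proof -
    define good where "good t \<longleftrightarrow> (\<exists>d\<ge>0. (h has_real_derivative d) (at t))" for t
    obtain N0 where N0: "N0 \<in> null_sets lborel" "{t. \<not> (t \<in> {a<..<b} \<longrightarrow> good t)} \<subseteq> N0"
      using deriv unfolding good_def eventually_ae_filter by (auto simp: space_lborel)
    \<comment> \<open>The end points count as bad points, so that every tag outside \<open>N\<close>
      lies in the open interval, where the hypothesis on the derivative applies.\<close>
    define N where "N = N0 \<union> {a, b}"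
    have "N \<in> null_sets lborel"
      unfolding N_def by (rule null_sets.Un[OF N0(1) finite_imp_null_set_lborel]) simp
    then have N: "N \<in> null_sets lebesgue"
      by (rule null_sets_completionI)
    obtain \<delta> where "\<delta> > 0" and \<delta>: "\<forall>(I :: (real \<times> real set) set) l r. finite I \<longrightarrow>
           (\<forall>i\<in>I. a \<le> l i \<and> l i \<le> r i \<and> r i \<le> b) \<longrightarrow>
           disjoint_family_on (\<lambda>i. {l i<..<r i}) I \<longrightarrow> (\<Sum>i\<in>I. r i - l i) < \<delta> \<longrightarrow>
           (\<Sum>i\<in>I. \<bar>h (r i) - h (l i)\<bar>) < \<epsilon>"
      using abs_cont_on_finiteD[OF ac \<open>\<epsilon> > 0\<close>] by blast
    obtain U where U: "open U" "N \<subseteq> U" "U - N \<in> lmeasurable" "emeasure lebesgue (U - N) < ennreal \<delta>"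
      using sets_lebesgue_outer_open[OF null_setsD2[OF N] \<open>\<delta> > 0\<close>] by metis
    have "emeasure lebesgue U \<le> emeasure lebesgue (U - N) + emeasure lebesgue N"
      using emeasure_subadditive[of "U - N" lebesgue N] U N
      by (auto simp: Un_absorb2 Un_Diff_cancel2 fmeasurableD)
    then have emU: "emeasure lebesgue U < ennreal \<delta>"
      using U(4) N by (simp add: null_setsD1)
    then have lmU: "U \<in> lmeasurable"
      using U(1) by (intro fmeasurableI) (auto simp: less_top[symmetric] top_unique dest: order.strict_trans)
    then have mU: "measure lebesgue U < \<delta>"
      using emU \<open>\<delta> > 0\<close> by (simp add: emeasure_eq_measure2 ennreal_less_iff)
    \<comment> \<open>Straddle estimate: subtracting the linear approximations at \<open>l\<close>
      and \<open>r\<close>, on the two sides of \<open>t\<close>, leaves an error proportional to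
      \<open>r - l\<close>, and the term \<open>d * (r - l)\<close> has the favourable sign.\<close>
    have "\<exists>\<eta>>0. \<forall>l r. l \<le> t \<and> t \<le> r \<and> t - l < \<eta> \<and> r - t < \<eta> \<longrightarrow> h l - h r \<le> \<epsilon> * (r - l)"
      if "good t" for t
    proof -
      obtain d where "d \<ge> 0" and d: "(h has_real_derivative d) (at t)"
        using \<open>good t\<close> by (auto simp: good_def)
      then have "(h has_derivative (*) d) (at t)"
        by (simp add: has_field_derivative_def)
      then obtain \<eta> where "\<eta> > 0" and \<eta>: "\<And>y. \<bar>y - t\<bar> < \<eta> \<Longrightarrow> \<bar>h y - h t - d * (y - t)\<bar> \<le> \<epsilon> * \<bar>y - t\<bar>"
        using \<open>\<epsilon> > 0\<close> unfolding has_derivative_at_alt real_norm_def by metis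
      have "h l - h r \<le> \<epsilon> * (r - l)" if "l \<le> t" "t \<le> r" "t - l < \<eta>" "r - t < \<eta>" for l r
      proof -
        have "\<bar>h l - h t - d * (l - t)\<bar> \<le> \<epsilon> * (t - l)" "\<bar>h r - h t - d * (r - t)\<bar> \<le> \<epsilon> * (r - t)"
          using \<eta>[of l] \<eta>[of r] that by auto
        moreover have "d * (r - l) \<ge> 0" using \<open>d \<ge> 0\<close> that by auto
        ultimately show ?thesis by (simp add: algebra_simps)
      qed
      then show ?thesis using \<open>\<eta> > 0\<close> by blast
    qed
    then obtain \<eta> where \<eta>pos: "\<And>t. good t \<Longrightarrow> \<eta> t > 0"
      and \<eta>: "\<And>t l r. \<lbrakk>good t; l \<le> t; t \<le> r; t - l < \<eta> t; r - t < \<eta> t\<rbrakk> \<Longrightarrow> h l - h r \<le> \<epsilon> * (r - l)"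
      by metis
    \<comment> \<open>A cell with a good tag is short enough for the straddle estimate, and a cell
      with its tag in \<open>N\<close> stays inside \<open>U\<close>. The value \<open>UNIV\<close>
      occurs only at points outside \<open>{a..b}\<close>, which are never tags.\<close>
    define G where "G t = (if t \<in> N then U else if good t then ball t (\<eta> t) else UNIV)" for t
    have "gauge G"
      unfolding gauge_def G_def using U \<eta>pos by auto
    then obtain p where p: "p tagged_division_of {a..b}" and fine: "G fine p"
      using fine_division_exists_real by blast
    note pD = tagged_division_ofD[OF p]
    have K: "K = {Inf K..Sup K} \<and> Inf K \<le> x \<and> x \<le> Sup K \<and> a \<le> Inf K \<and> Sup K \<le> b"
      if xK: "(x, K) \<in> p" for x K
    proof -
      obtain c d where cd: "K = {c..d}" using pD(4)[OF xK] by auto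
      then show ?thesis using pD(2,3)[OF xK] by auto
    qed
    define P where "P = {i \<in> p. fst i \<in> N}"
    have finP: "finite P" "finite p" using pD(1) by (auto simp: P_def)
    \<comment> \<open>The increments over the cells telescope; it remains to bound the good cells
      and the bad cells separately.\<close>
    have "(\<Sum>(x, K)\<in>p. h (Inf K) - h (Sup K)) = h a - h b"
      using additive_tagged_division_1[OF \<open>a \<le> b\<close> p, of "\<lambda>t. - h t"] by (simp add: minus_diff_minus)
    moreover have "(\<Sum>(x, K)\<in>p - P. h (Inf K) - h (Sup K)) \<le> \<epsilon> * (b - a)"
    proof -
      have "(\<Sum>(x, K)\<in>p - P. h (Inf K) - h (Sup K)) \<le> (\<Sum>(x, K)\<in>p - P. \<epsilon> * measure lborel K)"
      proof (rule sum_mono, clarify)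
        fix x K assume xK: "(x, K) \<in> p" "(x, K) \<notin> P"
        then have "x \<notin> N" by (auto simp: P_def)
        note Kx = K[OF xK(1)]
        have "x \<in> {a<..<b}"
          using Kx \<open>x \<notin> N\<close> by (auto simp: N_def order.order_iff_strict)
        then have "good x" using N0(2) \<open>x \<notin> N\<close> by (auto simp: N_def)
        have sub: "K \<subseteq> ball x (\<eta> x)"
          using fineD[OF fine xK(1)] \<open>x \<notin> N\<close> \<open>good x\<close> by (simp add: G_def)
        have "Inf K \<in> K" "Sup K \<in> K" using Kx
          by (metis atLeastAtMost_iff order.trans order_refl)+
        then have "dist x (Inf K) < \<eta> x" "dist x (Sup K) < \<eta> x"
          using sub by auto
        then have "h (Inf K) - h (Sup K) \<le> \<epsilon> * (Sup K - Inf K)"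
          using \<eta>[OF \<open>good x\<close>, of "Inf K" "Sup K"] Kx by (auto simp: dist_real_def)
        also have "Sup K - Inf K = measure lborel K"
          using Kx content_real[of "Inf K" "Sup K"] by (metis order.trans)
        finally show "h (Inf K) - h (Sup K) \<le> \<epsilon> * measure lborel K" .
      qed
      also have "\<dots> \<le> (\<Sum>(x, K)\<in>p. \<epsilon> * measure lborel K)"
        using finP \<open>\<epsilon> > 0\<close> by (intro sum_mono2) (auto simp: P_def)
      also have "\<dots> = \<epsilon> * (\<Sum>(x, K)\<in>p. measure lborel K)"
        by (simp add: sum_distrib_left case_prod_unfold)
      also have "\<dots> = \<epsilon> * (b - a)"
        using additive_content_tagged_division[of p a b] p \<open>a \<le> b\<close> by simp
      finally show ?thesis .
    qed
    moreover have "(\<Sum>(x, K)\<in>P. h (Inf K) - h (Sup K)) \<le> \<epsilon>"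
    proof -
      have disj: "disjoint_family_on (\<lambda>i. {Inf (snd i)<..<Sup (snd i)}) P"
        unfolding disjoint_family_on_def
      proof (intro ballI impI)
        fix i j assume ij: "i \<in> P" "j \<in> P" "i \<noteq> j"
        have int: "interior (snd k) = {Inf (snd k)<..<Sup (snd k)}" if "k \<in> P" for k
        proof -
          have "snd k = {Inf (snd k)..Sup (snd k)}"
            using K[of "fst k" "snd k"] that by (simp add: P_def)
          then show ?thesis by (metis interior_atLeastAtMost_real)
        qed
        have "interior (snd i) \<inter> interior (snd j) = {}"
          using pD(5)[of "fst i" "snd i" "fst j" "snd j"] ij by (simp add: P_def)
        then show "{Inf (snd i)<..<Sup (snd i)} \<inter> {Inf (snd j)<..<Sup (snd j)} = {}"
          using int ij by simp
      qed
      have bnd: "a \<le> Inf (snd i) \<and> Inf (snd i) \<le> Sup (snd i) \<and> Sup (snd i) \<le> b"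
        if "i \<in> P" for i
        using K[of "fst i" "snd i"] that by (auto simp: P_def)
      have sub: "{Inf (snd i)<..<Sup (snd i)} \<subseteq> U" if "i \<in> P" for i
      proof -
        have "snd i \<subseteq> U" using fineD[OF fine, of "fst i" "snd i"] that by (simp add: P_def G_def)
        moreover have "snd i = {Inf (snd i)..Sup (snd i)}"
          using K[of "fst i" "snd i"] that by (simp add: P_def)
        ultimately show ?thesis by (metis greaterThanLessThan_subseteq_atLeastAtMost_iff order.refl order.trans)
      qed
      have "(\<Sum>i\<in>P. Sup (snd i) - Inf (snd i))
          = (\<Sum>i\<in>P. measure lebesgue {Inf (snd i)<..<Sup (snd i)})"
        using bnd by (intro sum.cong) auto
      also have "\<dots> = measure lebesgue (\<Union>i\<in>P. {Inf (snd i)<..<Sup (snd i)})"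
        using finP disj bnd by (intro measure_finite_Union[symmetric]) (auto simp: emeasure_lborel_Ioo)
      also have "\<dots> \<le> measure lebesgue U"
        using sub lmU finP by (intro measure_mono_fmeasurable) auto
      finally have "(\<Sum>i\<in>P. Sup (snd i) - Inf (snd i)) < \<delta>" using mU by simp
      then have "(\<Sum>i\<in>P. \<bar>h (Sup (snd i)) - h (Inf (snd i))\<bar>) < \<epsilon>"
        using finP(1) bnd disj by (intro \<delta>[rule_format])
      moreover have "(\<Sum>(x, K)\<in>P. h (Inf K) - h (Sup K)) \<le> (\<Sum>i\<in>P. \<bar>h (Sup (snd i)) - h (Inf (snd i))\<bar>)"
        by (intro sum_mono) auto
      ultimately show ?thesis by simp
    qed
    moreover have "(\<Sum>(x, K)\<in>p. h (Inf K) - h (Sup K))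
        = (\<Sum>(x, K)\<in>p - P. h (Inf K) - h (Sup K)) + (\<Sum>(x, K)\<in>P. h (Inf K) - h (Sup K))"
      using finP by (intro sum.subset_diff) (auto simp: P_def)
    ultimately show ?thesis by simp
  qed
  show ?thesis
  proof (rule ccontr)
    assume "\<not> h a \<le> h b"
    \<comment> \<open>The factor \<open>c\<close> collects both error terms,
      \<open>\<epsilon> * (b - a)\<close> and \<open>\<epsilon>\<close>; with the chosen
      \<open>\<epsilon>\<close> they amount to half of the supposed drop.\<close>
    define c where "c = b - a + 1"
    define \<epsilon> where "\<epsilon> = (h a - h b) / (2 * c)"
    have "c > 0" using \<open>a \<le> b\<close> by (simp add: c_def)
    then have "\<epsilon> > 0" using \<open>\<not> h a \<le> h b\<close> by (simp add: \<epsilon>_def)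
    have "h a - h b \<le> \<epsilon> * c"
      using main[OF \<open>\<epsilon> > 0\<close>] by (simp add: c_def algebra_simps)
    also have "\<dots> = (h a - h b) / 2"
      using \<open>c > 0\<close> by (simp add: \<epsilon>_def)
    finally show False using \<open>\<not> h a \<le> h b\<close> by simp
  qed
qed

section \<open>Caratheodory solutions\<close>

text \<open>The difference of two solutions has derivative zero almost everywhere; monotonicity
  applied to it in both orders gives both inequalities.\<close>

lemma ode_sol_unique:
  assumes x: "ode_sol T g x" and y: "ode_sol T g y" and "x 0 = y 0" and t: "t \<in> {0..T}"
  shows "x t = y t"
proof -
  have le: "v t \<le> w t" if v: "ode_sol T g v" and w: "ode_sol T g w" and "v 0 = w 0" for v w
  proof -
    have "abs_cont_on 0 T (\<lambda>s. w s - v s)"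
      using v w by (auto simp: ode_sol_def intro: abs_cont_on_diff)
    then have ac: "abs_cont_on 0 t (\<lambda>s. w s - v s)"
      using t by (auto intro: abs_cont_on_subinterval)
    have "AE s\<in>{0<..<t} in lborel. \<exists>d\<ge>0. ((\<lambda>s. w s - v s) has_real_derivative d) (at s)"
    proof -
      have "AE s\<in>{0<..<T} in lborel. (v has_real_derivative g s) (at s)"
        "AE s\<in>{0<..<T} in lborel. (w has_real_derivative g s) (at s)"
        using v w by (auto simp: ode_sol_def)
      then show ?thesis
      proof (eventually_elim, intro impI exI conjI)
        fix s assume "s \<in> {0<..<T} \<longrightarrow> (v has_real_derivative g s) (at s)"
          "s \<in> {0<..<T} \<longrightarrow> (w has_real_derivative g s) (at s)" "s \<in> {0<..<t}"
        then show "((\<lambda>s. w s - v s) has_real_derivative 0) (at s)"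
          using t DERIV_diff[of w "g s" s UNIV v "g s"] by simp
      qed simp
    qed
    with ac show ?thesis
      using abs_cont_on_AE_deriv_nonneg_imp_le[of 0 t "\<lambda>s. w s - v s"] t \<open>v 0 = w 0\<close> by simp
  qed
  show ?thesis
    using le[OF x y] le[OF y x] \<open>x 0 = y 0\<close> by simp
qed

lemma ode_sol_cong_AE:
  assumes "ode_sol T g x" and "AE t\<in>{0<..<T} in lborel. g t = g' t"
  shows "ode_sol T g' x"
proof -
  have "AE t\<in>{0<..<T} in lborel. (x has_real_derivative g t) (at t)"
    using assms(1) by (simp add: ode_sol_def)
  with assms(2) have "AE t\<in>{0<..<T} in lborel. (x has_real_derivative g' t) (at t)"
    by eventually_elim auto
  then show ?thesis using assms(1) by (simp add: ode_sol_def)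
qed

section \<open>The play operator: uniqueness and explicit values\<close>

text \<open>The variational inequality is monotone: testing each play with the other shows that
  their squared distance cannot grow. The minus sign in \<open>?h\<close> turns this into a
  nonnegative derivative.\<close>

lemma is_play_unique:
  assumes w: "is_play \<rho> S u w0 w" and w': "is_play \<rho> S u w0 w'" and t: "t \<in> {0..S}"
  shows "w t = w' t"
proof -
  let ?h = "\<lambda>s. - ((w s - w' s)\<^sup>2)"
  have bnd: "\<bar>u s - w s\<bar> \<le> \<rho>" "\<bar>u s - w' s\<bar> \<le> \<rho>" if "s \<in> {0..S}" for s
    using w w' that by (auto simp: is_play_def)
  have "abs_cont_on 0 S ?h"
  proof (rule abs_cont_on_dominated)
    show "abs_cont_on 0 S w" "abs_cont_on 0 S w'" using w w' by (auto simp: is_play_def)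
    \<comment> \<open>Both plays stay within \<open>\<rho>\<close> of \<open>u\<close>, so
      \<open>w - w'\<close> is at most \<open>2 * \<rho>\<close> in modulus. Factoring the
      difference of two squares adds two such terms.\<close>
    show "4 * \<rho> \<ge> 0" using bnd[OF t] by linarith
    fix s r assume sr: "0 \<le> s" "s \<le> r" "r \<le> S"
    have "\<bar>?h r - ?h s\<bar> = \<bar>(w r - w' r) + (w s - w' s)\<bar> * \<bar>(w r - w s) - (w' r - w' s)\<bar>"
      unfolding abs_mult[symmetric] by (subst abs_minus_commute) (simp add: power2_eq_square algebra_simps)
    also have "\<dots> \<le> (4 * \<rho>) * (\<bar>w r - w s\<bar> + \<bar>w' r - w' s\<bar>)"
      using bnd[of r] bnd[of s] sr by (intro mult_mono) auto
    finally show "\<bar>?h r - ?h s\<bar> \<le> (4 * \<rho>) * (\<bar>w r - w s\<bar> + \<bar>w' r - w' s\<bar>)" .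
  qed
  then have ac: "abs_cont_on 0 t ?h"
    using t by (auto intro: abs_cont_on_subinterval)
  have "AE s\<in>{0<..<S} in lborel. \<exists>d. (w has_real_derivative d) (at s) \<and>
       (\<forall>v. \<bar>v\<bar> \<le> \<rho> \<longrightarrow> d * (u s - w s - v) \<ge> 0)"
    "AE s\<in>{0<..<S} in lborel. \<exists>d. (w' has_real_derivative d) (at s) \<and>
       (\<forall>v. \<bar>v\<bar> \<le> \<rho> \<longrightarrow> d * (u s - w' s - v) \<ge> 0)"
    using w w' by (auto simp: is_play_def)
  then have "AE s\<in>{0<..<t} in lborel. \<exists>d\<ge>0. (?h has_real_derivative d) (at s)"
  proof (eventually_elim, intro impI)
    fix s assume a: "s \<in> {0<..<S} \<longrightarrow> (\<exists>d. (w has_real_derivative d) (at s) \<and>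
        (\<forall>v. \<bar>v\<bar> \<le> \<rho> \<longrightarrow> 0 \<le> d * (u s - w s - v)))"
      "s \<in> {0<..<S} \<longrightarrow> (\<exists>d. (w' has_real_derivative d) (at s) \<and>
        (\<forall>v. \<bar>v\<bar> \<le> \<rho> \<longrightarrow> 0 \<le> d * (u s - w' s - v)))" and s: "s \<in> {0<..<t}"
    then obtain d d' where d: "(w has_real_derivative d) (at s)" "(w' has_real_derivative d') (at s)"
      and var: "\<And>v. \<bar>v\<bar> \<le> \<rho> \<Longrightarrow> 0 \<le> d * (u s - w s - v)" "\<And>v. \<bar>v\<bar> \<le> \<rho> \<Longrightarrow> 0 \<le> d' * (u s - w' s - v)"
      using t by auto
    \<comment> \<open>The test values \<open>u s - w' s\<close> and \<open>u s - w s\<close> are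
      admissible because both plays satisfy the constraint.\<close>
    have "d * (w' s - w s) \<ge> 0" "d' * (w s - w' s) \<ge> 0"
      using var(1)[of "u s - w' s"] var(2)[of "u s - w s"] bnd[of s] s t by auto
    then have "- (2 * (w s - w' s) * (d - d')) \<ge> 0"
      by (simp add: algebra_simps)
    moreover have "(?h has_real_derivative - (2 * (w s - w' s) * (d - d'))) (at s)"
      using d by (auto intro!: derivative_eq_intros)
    ultimately show "\<exists>d\<ge>0. (?h has_real_derivative d) (at s)" by blast
  qed
  with ac have "?h 0 \<le> ?h t"
    using t abs_cont_on_AE_deriv_nonneg_imp_le[of 0 t ?h] by simp
  moreover have "w 0 = w' 0" using w w' by (simp add: is_play_def)
  ultimately show ?thesis by simp
qed

text \<open>Values outside \<open>{0..S}\<close> are irrelevant since derivatives are taken only at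
  interior points. This covers the extensional restriction of a play, and inputs known only on the
  time interval.\<close>

lemma is_play_cong:
  assumes "is_play \<rho> S u w0 w" and "S \<ge> 0"
    and u: "\<And>t. t \<in> {0..S} \<Longrightarrow> u' t = u t" and w: "\<And>t. t \<in> {0..S} \<Longrightarrow> w' t = w t"
  shows "is_play \<rho> S u' w0 w'"
proof -
  have "abs_cont_on 0 S w"
    using assms by (simp add: is_play_def)
  then have "abs_cont_on 0 S w'"
    by (rule abs_cont_on_dominated[of _ _ _ w 1]) (use assms w in \<open>auto simp: is_play_def\<close>)
  moreover have "(w' has_real_derivative d) (at t)"
    if "(w has_real_derivative d) (at t)" "t \<in> {0<..<S}" for d t
    using that w by (auto intro: has_field_derivative_transform_within_open[of w d t "{0<..<S}"])
  ultimately show ?thesis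
    using assms unfolding is_play_def by (auto elim!: eventually_mono simp: u w)
qed

lemma play_eq:
  assumes play: "is_play \<rho> S u w0 w" and "t \<in> {0..S}"
  shows "play \<rho> S u w0 t = w t"
proof -
  have "S \<ge> 0" using assms by auto
  have "play \<rho> S u w0 = restrict w {0..S}"
    unfolding play_def
  proof (rule the_equality)
    show "restrict w {0..S} \<in> extensional {0..S} \<and> is_play \<rho> S u w0 (restrict w {0..S})"
      using is_play_cong[OF play \<open>S \<ge> 0\<close>, of u "restrict w {0..S}"] by simp
  next
    fix v assume v: "v \<in> extensional {0..S} \<and> is_play \<rho> S u w0 v"
    then show "v = restrict w {0..S}"
      using is_play_unique[OF _ play, of v] by (auto intro!: extensionalityI[of _ "{0..S}"])
  qed
  then show ?thesis using assms by simp
qed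

text \<open>For a monotone input, the play with initial value \<open>w\<close> is a function of the current
  input value \<open>x\<close> only.\<close>

definition clamp_play :: "real \<Rightarrow> real \<Rightarrow> real \<Rightarrow> real" where
  "clamp_play \<rho> w x = max (x - \<rho>) (min w (x + \<rho>))"

text \<open>Away from the thresholds the clamp is locally constant or a shift of the input by
  \<open>\<rho>\<close>. If the input is beyond a threshold, the initial bound shows that it moved
  there, which fixes the sign of \<open>k\<close>. Then \<open>X - W\<close> is the extreme
  admissible value on that side, so the inequality holds with \<open>d = k\<close>.\<close>

lemma clamp_play_affine_deriv:
  fixes X W :: "real \<Rightarrow> real"
  assumes "\<rho> > 0" and init: "\<bar>m - w\<bar> \<le> \<rho>"
    and X: "\<And>s. s \<in> {l<..<r} \<Longrightarrow> X s = m + k * (s - l)"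
    and W: "\<And>s. s \<in> {l<..<r} \<Longrightarrow> W s = clamp_play \<rho> w (X s)"
    and t: "t \<in> {l<..<r}" and reg: "k = 0 \<or> X t \<noteq> w + \<rho> \<and> X t \<noteq> w - \<rho>"
  shows "\<exists>d. (W has_real_derivative d) (at t) \<and> (\<forall>v. \<bar>v\<bar> \<le> \<rho> \<longrightarrow> d * (X t - W t - v) \<ge> 0)"
proof -
  consider "k = 0" | "k \<noteq> 0" "X t > w + \<rho>" | "k \<noteq> 0" "X t < w - \<rho>"
    | "w - \<rho> < X t" "X t < w + \<rho>"
    using reg by linarith
  then show ?thesis
  proof cases
    case 1
    have "(W has_real_derivative 0) (at t)"
      by (rule has_field_derivative_transform_within_open[of "\<lambda>_. clamp_play \<rho> w m" _ _ "{l<..<r}"])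
        (use t X W 1 in auto)
    then show ?thesis by (intro exI[of _ 0]) simp
  next
    case 2
    have "k * (t - l) > 0" using 2 X[OF t] init by linarith
    then have "k > 0" using t by (simp add: zero_less_mult_iff)
    have "(W has_real_derivative k) (at t)"
    proof (rule has_field_derivative_transform_within_open)
      show "open ({l<..<r} \<inter> {s. m + k * (s - l) > w + \<rho>})"
        by (intro open_Int open_Collect_less continuous_intros open_greaterThanLessThan)
      show "((\<lambda>s. m + k * (s - l) - \<rho>) has_real_derivative k) (at t)"
        by (auto intro!: derivative_eq_intros)
    qed (use t 2 X W \<open>\<rho> > 0\<close> in \<open>auto simp: clamp_play_def\<close>)
    moreover have "X t - W t = \<rho>" using W[OF t] 2 \<open>\<rho> > 0\<close> by (auto simp: clamp_play_def)
    ultimately show ?thesis using \<open>k > 0\<close> by (intro exI[of _ k]) auto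
  next
    case 3
    have "k * (t - l) < 0" using 3 X[OF t] init by linarith
    then have "k < 0" using t by (simp add: mult_less_0_iff)
    have "(W has_real_derivative k) (at t)"
    proof (rule has_field_derivative_transform_within_open)
      show "open ({l<..<r} \<inter> {s. m + k * (s - l) < w - \<rho>})"
        by (intro open_Int open_Collect_less continuous_intros open_greaterThanLessThan)
      show "((\<lambda>s. m + k * (s - l) + \<rho>) has_real_derivative k) (at t)"
        by (auto intro!: derivative_eq_intros)
    qed (use t 3 X W \<open>\<rho> > 0\<close> in \<open>auto simp: clamp_play_def\<close>)
    moreover have "X t - W t = - \<rho>" using W[OF t] 3 \<open>\<rho> > 0\<close> by (auto simp: clamp_play_def)
    ultimately show ?thesis using \<open>k < 0\<close>
      by (intro exI[of _ k]) (auto intro!: mult_nonpos_nonpos)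
  next
    case 4
    have "(W has_real_derivative 0) (at t)"
    proof (rule has_field_derivative_transform_within_open)
      show "open ({l<..<r} \<inter> {s. w - \<rho> < m + k * (s - l)} \<inter> {s. m + k * (s - l) < w + \<rho>})"
        by (intro open_Int open_Collect_less continuous_intros open_greaterThanLessThan)
      show "((\<lambda>s. w) has_real_derivative 0) (at t)"
        by simp
    qed (use t 4 X W in \<open>auto simp: clamp_play_def\<close>)
    then show ?thesis by (intro exI[of _ 0]) simp
  qed
qed

lemma clamp_play_affine_AE:
  fixes X W :: "real \<Rightarrow> real"
  assumes "\<rho> > 0" and "\<bar>m - w\<bar> \<le> \<rho>"
    and X: "\<And>s. s \<in> {l<..<r} \<Longrightarrow> X s = m + k * (s - l)"
    and "\<And>s. s \<in> {l<..<r} \<Longrightarrow> W s = clamp_play \<rho> w (X s)"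
  shows "AE t\<in>{l<..<r} in lborel. \<exists>d. (W has_real_derivative d) (at t) \<and>
           (\<forall>v. \<bar>v\<bar> \<le> \<rho> \<longrightarrow> d * (X t - W t - v) \<ge> 0)"
proof -
  \<comment> \<open>These are the times at which the input meets \<open>w + \<rho>\<close> and
    \<open>w - \<rho>\<close>. For \<open>k = 0\<close> the quotients are the default 0, which is
    harmless because the regularity condition then holds trivially.\<close>
  have "AE t in lborel. t \<notin> {l + (w + \<rho> - m) / k, l + (w - \<rho> - m) / k}"
    by (intro AE_not_in finite_imp_null_set_lborel) auto
  then show ?thesis
  proof (eventually_elim, intro impI)
    fix t assume t: "t \<notin> {l + (w + \<rho> - m) / k, l + (w - \<rho> - m) / k}" "t \<in> {l<..<r}"
    have "k = 0 \<or> X t \<noteq> w + \<rho> \<and> X t \<noteq> w - \<rho>"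
      using t X[OF t(2)] by (auto simp: field_simps)
    then show "\<exists>d. (W has_real_derivative d) (at t) \<and> (\<forall>v. \<bar>v\<bar> \<le> \<rho> \<longrightarrow> d * (X t - W t - v) \<ge> 0)"
      using clamp_play_affine_deriv assms t(2) by blast
  qed
qed

section \<open>Nonconstancy of \<open>f\<close>\<close>

lemma nonhyst_controllable_imp_nonconstant:
  assumes "nonhyst_controllable f"
  shows "\<exists>b. f b \<noteq> f a"
proof -
  have False if const: "\<And>b. f b = f a"
  proof -
    \<comment> \<open>The target returns \<open>y\<close> to 0 but asks for \<open>z = 1\<close>,
      which contradicts the conserved quantity.\<close>
    obtain T u1 u2 x y z where "T > 0" and sol: "nonhyst_sol f T u1 u2 (0, 0, 0) x y z"
      and fin: "(x T, y T, z T) = (0, 0, 1)"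
      using assms unfolding nonhyst_controllable_def nonhyst_steers_def by meson
    have "(\<lambda>t. f (x t) * u2 t) = (\<lambda>t. f a * u2 t)"
      using const[of "x _"] by metis
    then have y: "ode_sol T u2 y" and z: "ode_sol T (\<lambda>t. f a * u2 t) z"
      using sol by (auto simp: nonhyst_sol_def)
    have "abs_cont_on 0 T (\<lambda>t. f a * y t)"
      by (rule abs_cont_on_dominated[of _ _ y y "\<bar>f a\<bar>"])
        (use y in \<open>auto simp: ode_sol_def right_diff_distrib[symmetric] abs_mult mult_left_mono\<close>)
    then have "ode_sol T (\<lambda>t. f a * u2 t) (\<lambda>t. f a * y t)"
      using y unfolding ode_sol_def
      by (auto elim!: eventually_mono intro: DERIV_cmult)
    then have "z T = f a * y T"
      using ode_sol_unique[OF z, of "\<lambda>t. f a * y t" T] \<open>T > 0\<close> sol by (simp add: nonhyst_sol_def)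
    moreover have "y T = 0" "z T = 1" using fin by auto
    ultimately show False by simp
  qed
  then show ?thesis by blast
qed

section \<open>Piecewise affine trajectories and their controls\<close>

definition ramp :: "real \<Rightarrow> real \<Rightarrow> real" where
  "ramp h s = max 0 (min h s)"

text \<open>Each of the three state components moves in exactly two windows of length
  \<open>h\<close>, so this shape serves all of them, \<open>z\<close> included.\<close>

definition two_ramps :: "real \<Rightarrow> real \<Rightarrow> real \<Rightarrow> real \<Rightarrow> real \<Rightarrow> real \<Rightarrow> real \<Rightarrow> real" where
  "two_ramps h c1 c2 k1 k2 m t = m + k1 * ramp h (t - c1) + k2 * ramp h (t - c2)"

definition two_bumps :: "real \<Rightarrow> real \<Rightarrow> real \<Rightarrow> real \<Rightarrow> real \<Rightarrow> real \<Rightarrow> real" where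
  "two_bumps h c1 c2 k1 k2 t =
     k1 * of_bool (c1 < t \<and> t < c1 + h) + k2 * of_bool (c2 < t \<and> t < c2 + h)"

lemma lipschitz_two_ramps: "(\<bar>k1\<bar> + \<bar>k2\<bar>)-lipschitz_on U (two_ramps h c1 c2 k1 k2 m)"
proof (rule lipschitz_onI)
  fix s t
  have ramp: "\<bar>ramp h (s - c) - ramp h (t - c)\<bar> \<le> \<bar>s - t\<bar>" for c
    by (auto simp: ramp_def max_def min_def)
  have "\<bar>two_ramps h c1 c2 k1 k2 m s - two_ramps h c1 c2 k1 k2 m t\<bar>
      = \<bar>k1 * (ramp h (s - c1) - ramp h (t - c1)) + k2 * (ramp h (s - c2) - ramp h (t - c2))\<bar>"
    by (simp add: two_ramps_def algebra_simps)
  also have "\<dots> \<le> \<bar>k1\<bar> * \<bar>ramp h (s - c1) - ramp h (t - c1)\<bar> + \<bar>k2\<bar> * \<bar>ramp h (s - c2) - ramp h (t - c2)\<bar>"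
    by (metis abs_mult abs_triangle_ineq)
  also have "\<dots> \<le> \<bar>k1\<bar> * \<bar>s - t\<bar> + \<bar>k2\<bar> * \<bar>s - t\<bar>"
    using ramp by (intro add_mono mult_left_mono) auto
  finally show "dist (two_ramps h c1 c2 k1 k2 m s) (two_ramps h c1 c2 k1 k2 m t)
      \<le> (\<bar>k1\<bar> + \<bar>k2\<bar>) * dist s t"
    by (simp add: dist_real_def distrib_right)
qed simp

lemma ramp_deriv:
  assumes "h > 0" and t: "t \<noteq> c" "t \<noteq> c + h"
  shows "((\<lambda>t. ramp h (t - c)) has_real_derivative of_bool (c < t \<and> t < c + h)) (at t)"
proof -
  consider "t < c" | "c < t" "t < c + h" | "t > c + h" using t by linarith
  then show ?thesis
  proof cases
    case 1
    show ?thesis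
      by (rule has_field_derivative_transform_within_open[of "\<lambda>_. 0" _ _ "{..<c}"])
        (use 1 \<open>h > 0\<close> in \<open>auto simp: ramp_def\<close>)
  next
    case 2
    show ?thesis
      by (rule has_field_derivative_transform_within_open[of "\<lambda>t. t - c" _ _ "{c<..<c+h}"])
        (use 2 \<open>h > 0\<close> in \<open>auto simp: ramp_def intro!: derivative_eq_intros\<close>)
  next
    case 3
    show ?thesis
      by (rule has_field_derivative_transform_within_open[of "\<lambda>_. h" _ _ "{c+h<..}"])
        (use 3 \<open>h > 0\<close> in \<open>auto simp: ramp_def\<close>)
  qed
qed

lemma ode_sol_two_ramps:
  assumes "h > 0"
  shows "ode_sol S (two_bumps h c1 c2 k1 k2) (two_ramps h c1 c2 k1 k2 m)"
proof -
  have "AE t in lborel. t \<notin> {c1, c1 + h, c2, c2 + h}"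
    by (intro AE_not_in finite_imp_null_set_lborel) auto
  then have "AE t\<in>{0<..<S} in lborel.
      (two_ramps h c1 c2 k1 k2 m has_real_derivative two_bumps h c1 c2 k1 k2 t) (at t)"
  proof eventually_elim
    fix t assume "t \<notin> {c1, c1 + h, c2, c2 + h}"
    then show "t \<in> {0<..<S} \<longrightarrow>
        (two_ramps h c1 c2 k1 k2 m has_real_derivative two_bumps h c1 c2 k1 k2 t) (at t)"
      using ramp_deriv[OF assms, of t c1] ramp_deriv[OF assms, of t c2]
      unfolding two_ramps_def[abs_def] two_bumps_def
      by (auto simp del: of_bool_conj intro!: derivative_eq_intros)
  qed
  then show ?thesis
    unfolding ode_sol_def using lipschitz_on_imp_abs_cont_on[OF lipschitz_two_ramps] by blast
qed

text \<open>With starting times on the grid of multiples of \<open>T\<close>, each bump fills one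
  open cell of the grid, and two open cells of length \<open>T\<close> meet only if they
  coincide.\<close>

lemma pw_const_on_two_bumps:
  assumes "T > 0"
  shows "pw_const_on (real n * T) (two_bumps T (real i * T) (real j * T) k1 k2)"
  unfolding pw_const_on_def
proof (intro exI[of _ n] exI[of _ "\<lambda>i. real i * T"] conjI allI impI)
  fix m :: nat
  have eq: "two_bumps T (real i * T) (real j * T) k1 k2 s = k1 * of_bool (i = m) + k2 * of_bool (j = m)"
    if "s \<in> {real m * T<..<real (Suc m) * T}" for s
  proof -
    have s: "real m * T < s" "s < real m * T + T"
      using that by (auto simp: algebra_simps)
    have "real i * T < s \<and> s < real i * T + T \<longleftrightarrow> i = m" for i
    proof
      assume "real i * T < s \<and> s < real i * T + T"
      then have "real i * T < (real m + 1) * T" "real m * T < (real i + 1) * T"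
        using s by (auto simp: algebra_simps)
      then have "real i < real m + 1" "real m < real i + 1"
        using \<open>T > 0\<close> by (simp_all only: mult_less_cancel_right_pos)
      then show "i = m" by linarith
    next
      assume "i = m"
      then show "real i * T < s \<and> s < real i * T + T" using s by blast
    qed
    then show ?thesis by (simp only: two_bumps_def)
  qed
  show "\<exists>c. \<forall>s\<in>{real m * T<..<real (Suc m) * T}. two_bumps T (real i * T) (real j * T) k1 k2 s = c"
    by (intro exI ballI) (erule eq)
qed (use assms in auto)

theorem theorem3p2:
  fixes f :: "real \<Rightarrow> real" and \<rho> T w0 :: real
    and xA yA zA xB yB zB :: real
    and ubar1 ubar2 :: "real \<Rightarrow> real"
  assumes "smooth f"
    and "nonhyst_controllable f"
    and "\<rho> > 0"
    and "T > 0"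
    and "pw_const_on T ubar1" and "pw_const_on T ubar2"
    and "nonhyst_steers f T ubar1 ubar2 (xA, yA, zA) (xB, yB, zB)"
    and "\<bar>xA - w0\<bar> \<le> \<rho>"
  shows "\<exists>(u1 :: nat \<Rightarrow> real \<Rightarrow> real) (u2 :: nat \<Rightarrow> real \<Rightarrow> real) Tstar. Tstar \<ge> T \<and>
    (\<forall>j. pw_const_on Tstar (u1 j) \<and> pw_const_on Tstar (u2 j)) \<and>
    (\<forall>j. \<exists>x y z. hyst_sol f \<rho> w0 Tstar (u1 j) (u2 j) (xA, yA, zA) x y z) \<and>
    (\<forall>x y z. (\<forall>j. hyst_sol f \<rho> w0 Tstar (u1 j) (u2 j) (xA, yA, zA) (x j) (y j) (z j)) \<longrightarrow>
       (\<forall>j. x j Tstar = xB \<and> y j Tstar = yB) \<and> (\<lambda>j. z j Tstar) \<longlonglongrightarrow> zB)"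
proof -
  obtain b where b: "f b \<noteq> f w0"
    using nonhyst_controllable_imp_nonconstant[OF \<open>nonhyst_controllable f\<close>] by blast
  \<comment> \<open>The play trails a moving input by \<open>\<rho>\<close>, so the overshoot must
    be on the side of \<open>b\<close> that is away from \<open>w0\<close>.\<close>
  define c where "c = (if w0 < b then b + \<rho> else b - \<rho>)"
  define k1 where "k1 = (c - xA) / T"
  define k2 where "k2 = (xB - c) / T"
  \<comment> \<open>With speeds \<open>p\<close> and \<open>q\<close> in the two moves of
    \<open>y\<close>, the requirements are \<open>T * (p + q) = yB - yA\<close> and
    \<open>T * (f w0 * p + f b * q) = zB - zA\<close>; eliminating \<open>p\<close> gives
    \<open>q\<close>.\<close>
  define q where "q = (zB - zA - f w0 * (yB - yA)) / (T * (f b - f w0))"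
  define p where "p = (yB - yA) / T - q"
  define X where "X = two_ramps T (1 * T) (3 * T) k1 k2 xA"
  define Y where "Y = two_ramps T (0 * T) (2 * T) p q yA"
  define Z where "Z = two_ramps T (0 * T) (2 * T) (f w0 * p) (f b * q) zA"
  define U1 where "U1 = two_bumps T (1 * T) (3 * T) k1 k2"
  define U2 where "U2 = two_bumps T (0 * T) (2 * T) p q"
  \<comment> \<open>Freezing the inner input at \<open>3 * T\<close> makes the inner clamp the play
    value reached there, which restarts the play for the last phase. Before that time both clamps
    see the same input and the outer one changes nothing. A single formula for all times gives
    continuity across the phases at once.\<close>
  define W where "W t = clamp_play \<rho> (clamp_play \<rho> w0 (X (min t (3 * T)))) (X t)" for t
  have "b \<noteq> w0" using b by auto
  note pos = \<open>\<rho> > 0\<close> \<open>T > 0\<close>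
  have X1: "X t = xA + 0 * (t - 0)" if "t \<in> {0..T}" for t
    using that pos by (auto simp: X_def two_ramps_def ramp_def)
  have X2: "X t = xA + k1 * (t - T)" if "t \<in> {T..2*T}" for t
    using that pos by (auto simp: X_def two_ramps_def ramp_def)
  have X3: "X t = c + 0 * (t - 2 * T)" if "t \<in> {2*T..3*T}" for t
    using that pos by (auto simp: X_def two_ramps_def ramp_def k1_def)
  have X4: "X t = c + k2 * (t - 3 * T)" if "t \<in> {3*T..4*T}" for t
    using that pos by (auto simp: X_def two_ramps_def ramp_def k1_def)
  have clamp_w0: "clamp_play \<rho> w0 xA = w0"
    using \<open>\<bar>xA - w0\<bar> \<le> \<rho>\<close> by (auto simp: clamp_play_def)
  have clamp_c: "clamp_play \<rho> w0 c = b"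
    using \<open>b \<noteq> w0\<close> pos by (auto simp: clamp_play_def c_def)
  have clamp_b: "clamp_play \<rho> b c = b"
    using pos by (auto simp: clamp_play_def c_def)
  have W012: "W t = clamp_play \<rho> w0 (X t)" if "t \<le> 3 * T" for t
    using that pos by (auto simp: W_def clamp_play_def)
  \<comment> \<open>On the third phase the input rests at \<open>c\<close>, and clamping there gives
    \<open>b\<close> from either \<open>w0\<close> or \<open>b\<close>, so the new initial value may
    be used from \<open>2 * T\<close> on.\<close>
  have W3: "W t = clamp_play \<rho> b (X t)" if "t \<in> {2*T..4*T}" for t
  proof (cases "t \<le> 3 * T")
    case True
    then show ?thesis using W012[OF True] X3 that clamp_c clamp_b by simp
  next
    case False
    then show ?thesis using X3[of "3 * T"] pos clamp_c by (simp add: W_def)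
  qed
  have play: "is_play \<rho> (4 * T) X w0 W"
    unfolding is_play_def
  proof (intro conjI ballI)
    let ?L = "\<bar>k1\<bar> + \<bar>k2\<bar>"
    have "\<bar>W s - W t\<bar> \<le> ?L * \<bar>s - t\<bar>" for s t
    proof -
      have X: "\<bar>X s' - X t'\<bar> \<le> ?L * \<bar>s' - t'\<bar>" for s' t'
        using lipschitz_onD[OF lipschitz_two_ramps[of k1 k2 UNIV], of s' t'] by (simp add: X_def dist_real_def)
      \<comment> \<open>The clamp is nonexpansive jointly in both arguments for the maximum norm, so
        nesting does not enlarge the Lipschitz constant of \<open>X\<close>.\<close>
      have cl: "\<bar>clamp_play \<rho> w x - clamp_play \<rho> w' x'\<bar> \<le> max \<bar>w - w'\<bar> \<bar>x - x'\<bar>" for w w' x x'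
        by (auto simp: clamp_play_def max_def min_def)
      have "\<bar>W s - W t\<bar> \<le> max \<bar>X (min s (3*T)) - X (min t (3*T))\<bar> \<bar>X s - X t\<bar>"
        unfolding W_def using cl[of w0 _ w0] by (intro order.trans[OF cl max.mono]) auto
      also have "\<dots> \<le> ?L * \<bar>s - t\<bar>"
      proof (rule max.boundedI)
        have "?L * \<bar>min s (3*T) - min t (3*T)\<bar> \<le> ?L * \<bar>s - t\<bar>"
          by (intro mult_left_mono) auto
        then show "\<bar>X (min s (3*T)) - X (min t (3*T))\<bar> \<le> ?L * \<bar>s - t\<bar>"
          using X[of "min s (3*T)" "min t (3*T)"] by linarith
      qed (rule X)
      finally show ?thesis .
    qed
    then have "?L-lipschitz_on {0..4*T} W"
      by (intro lipschitz_onI) (auto simp: dist_real_def)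
    then show "abs_cont_on 0 (4 * T) W"
      by (rule lipschitz_on_imp_abs_cont_on)
    show "W 0 = w0" using W012[of 0] X1[of 0] pos clamp_w0 by simp
    have "\<bar>x - clamp_play \<rho> w x\<bar> \<le> \<rho>" for w x
      using pos by (auto simp: clamp_play_def max_def min_def)
    then show "\<bar>X t - W t\<bar> \<le> \<rho>" for t
      by (simp add: W_def)
    let ?P = "\<lambda>t. \<exists>d. (W has_real_derivative d) (at t) \<and> (\<forall>v. \<bar>v\<bar> \<le> \<rho> \<longrightarrow> d * (X t - W t - v) \<ge> 0)"
    have cb: "\<bar>c - b\<bar> \<le> \<rho>" using pos by (auto simp: c_def)
    have "AE t\<in>{0<..<T} in lborel. ?P t"
      using W012 X1 pos \<open>\<bar>xA - w0\<bar> \<le> \<rho>\<close> by (intro clamp_play_affine_AE[of _ xA w0 _ _ _ 0]) auto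
    moreover have "AE t\<in>{T<..<2*T} in lborel. ?P t"
      using W012 X2 pos \<open>\<bar>xA - w0\<bar> \<le> \<rho>\<close> by (intro clamp_play_affine_AE[of _ xA w0 _ _ _ k1]) auto
    moreover have "AE t\<in>{2*T<..<3*T} in lborel. ?P t"
      using W3 X3 pos cb by (intro clamp_play_affine_AE[of _ c b _ _ _ 0]) auto
    moreover have "AE t\<in>{3*T<..<4*T} in lborel. ?P t"
      using W3 X4 pos cb by (intro clamp_play_affine_AE[of _ c b _ _ _ k2]) auto
    moreover have "AE t in lborel. t \<notin> {T, 2*T, 3*T}"
      by (intro AE_not_in finite_imp_null_set_lborel) auto
    ultimately show "AE t\<in>{0<..<4*T} in lborel. ?P t"
    proof eventually_elim
      case (elim t)
      show ?case
      proof
        assume "t \<in> {0<..<4*T}"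
        then have "t \<in> {0<..<T} \<or> t \<in> {T<..<2*T} \<or> t \<in> {2*T<..<3*T} \<or> t \<in> {3*T<..<4*T}"
          using elim(5) by auto
        then show "?P t" using elim(1-4) by blast
      qed
    qed
  qed
  have x_sol: "ode_sol (4 * T) U1 X" and y_sol: "ode_sol (4 * T) U2 Y"
    unfolding U1_def U2_def X_def Y_def using pos by (auto intro: ode_sol_two_ramps)
  have init: "X 0 = xA" "Y 0 = yA" "Z 0 = zA"
    using pos by (auto simp: X_def Y_def Z_def two_ramps_def ramp_def)
  \<comment> \<open>The input is kept general because the first component of an arbitrary solution
    is known to agree with \<open>X\<close> only on the time interval.\<close>
  have z_sol: "ode_sol (4 * T) (\<lambda>t. f (play \<rho> (4 * T) x w0 t) * U2 t) Z"
    if x: "\<And>t. t \<in> {0..4*T} \<Longrightarrow> x t = X t" for x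
  proof (rule ode_sol_cong_AE)
    show "ode_sol (4 * T) (two_bumps T (0 * T) (2 * T) (f w0 * p) (f b * q)) Z"
      unfolding Z_def by (rule ode_sol_two_ramps[OF \<open>T > 0\<close>])
    have "is_play \<rho> (4 * T) x w0 W"
      using is_play_cong[OF play, of x W] x pos by simp
    then have W: "play \<rho> (4 * T) x w0 t = W t" if "t \<in> {0..4*T}" for t
      using that by (rule play_eq)
    \<comment> \<open>Where \<open>U2\<close> vanishes the value of the play is irrelevant; on its
      two bumps the play is constantly \<open>w0\<close> and \<open>b\<close>.\<close>
    have "two_bumps T (0 * T) (2 * T) (f w0 * p) (f b * q) t = f (W t) * U2 t" for t
    proof -
      consider "t \<in> {0<..<T}" | "t \<in> {2*T<..<3*T}" | "\<not> (0 < t \<and> t < T)" "\<not> (2*T < t \<and> t < 3*T)"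
        by force
      then show ?thesis
      proof cases
        case 1
        then have "W t = w0" using W012[of t] X1[of t] clamp_w0 by simp
        then show ?thesis using 1 by (auto simp: U2_def two_bumps_def)
      next
        case 2
        then have "W t = b" using W3[of t] X3[of t] clamp_b pos by simp
        then show ?thesis using 2 pos by (auto simp: U2_def two_bumps_def)
      next
        case 3
        then show ?thesis by (auto simp: U2_def two_bumps_def)
      qed
    qed
    then show "AE t\<in>{0<..<4*T} in lborel. two_bumps T (0 * T) (2 * T) (f w0 * p) (f b * q) t
        = f (play \<rho> (4 * T) x w0 t) * U2 t"
      using W by (intro AE_I2) simp
  qed
  have "X (4 * T) = xB" "Y (4 * T) = yB"
    using pos by (auto simp: X_def Y_def two_ramps_def ramp_def k1_def k2_def p_def field_simps)
  have "Z (4 * T) = zA + (f w0 * (yB - yA) + (f b - f w0) * (q * T))"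
    using pos by (auto simp: Z_def two_ramps_def ramp_def p_def field_simps)
  also have "\<dots> = zB"
    using pos b by (simp add: q_def)
  finally have "Z (4 * T) = zB" .
  have sol: "hyst_sol f \<rho> w0 (4 * T) U1 U2 (xA, yA, zA) X Y Z"
    using x_sol y_sol z_sol[of X] init by (simp add: hyst_sol_def)
  \<comment> \<open>The order matters: \<open>x\<close> is identified first, since the right-hand
    side for \<open>z\<close> depends on it through the play.\<close>
  have reach: "x (4 * T) = xB \<and> y (4 * T) = yB \<and> z (4 * T) = zB"
    if sol: "hyst_sol f \<rho> w0 (4 * T) U1 U2 (xA, yA, zA) x y z" for x y z
  proof -
    have x: "x t = X t" if "t \<in> {0..4*T}" for t
      using ode_sol_unique[OF _ x_sol, of x t] sol init that by (simp add: hyst_sol_def)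
    moreover have "y (4 * T) = Y (4 * T)"
      using ode_sol_unique[OF _ y_sol, of y "4 * T"] sol init pos by (simp add: hyst_sol_def)
    moreover have "z (4 * T) = Z (4 * T)"
      using ode_sol_unique[OF _ z_sol[of x], of z "4 * T"] x sol init pos by (simp add: hyst_sol_def)
    ultimately show ?thesis
      using \<open>X (4 * T) = xB\<close> \<open>Y (4 * T) = yB\<close> \<open>Z (4 * T) = zB\<close> pos by simp
  qed
  have pw: "pw_const_on (4 * T) U1" "pw_const_on (4 * T) U2"
    using pw_const_on_two_bumps[OF \<open>T > 0\<close>, of 4 1 3 k1 k2] pw_const_on_two_bumps[OF \<open>T > 0\<close>, of 4 0 2 p q]
    by (simp_all add: U1_def U2_def)
  show ?thesis
  proof (rule exI[of _ "\<lambda>_. U1"], rule exI[of _ "\<lambda>_. U2"], rule exI[of _ "4 * T"], intro conjI allI impI)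
    fix x y z :: "nat \<Rightarrow> real \<Rightarrow> real"
    assume "\<forall>j. hyst_sol f \<rho> w0 (4 * T) U1 U2 (xA, yA, zA) (x j) (y j) (z j)"
    then have *: "x j (4 * T) = xB \<and> y j (4 * T) = yB \<and> z j (4 * T) = zB" for j
      by (intro reach) blast
    then show "x j (4 * T) = xB" "y j (4 * T) = yB" for j by auto
    show "(\<lambda>j. z j (4 * T)) \<longlonglongrightarrow> zB" using * by simp
  qed (use pos pw sol in auto)
qed

end
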